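(* Let $c_0,c_h\in\mathbb{R}$ be constants. In three space dimensions, the reversible heat-GLM system $$\partial_t T+c_0\nabla\cdot\mathbf{J}=0,\qquad \partial_t\mathbf{J}+c_0\nabla T+c_h\nabla\times\boldsymbol{\psi}=0,$$ $$\partial_t\boldsymbol{\psi}-c_h\nabla\times\mathbf{J}+c_h\nabla\varphi=0,\qquad \partial_t\varphi+c_h\nabla\cdot\boldsymbol{\psi}=0$$ for $T,\varphi\in\mathbb{R}$ and $\mathbf{J},\boldsymbol{\psi}\in\mathbb{R}^3$ can be written, with $\mathbf{Q}=(J_1,J_2,J_3,\varphi,\psi_1,\psi_2,\psi_3,T)^{\mathsf T}$, as $$\partial_t\mathbf{Q}+\sum_{i=1}^3\mathbf{B}_i\,\partial_{x_i}\mathbf{Q}=0,$$ where $\mathbf{B}_1,\mathbf{B}_2,\mathbf{B}_3$ are constant $8\times8$ matrices such that $\sum_{i=1}^3\beta_i\mathbf{B}_i$ is symmetric for every $(\beta_1,\beta_2,\beta_3)\in\mathbb{R}^3$; that is, the system is symmetric $t$-hyperbolic in the sense of Friedrichs. Moreover, the characteristic speeds in the $x_1$-direction, i.e. the eigenvalues of $\mathbf{B}_1$ counted with multiplicity, are $-c_0$, $-c_h$ (three times), $c_h$ (three times), and $c_0$.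
   Context: All fields are functions of $(\mathbf{x},t)$ with $\mathbf{x}=(x_1,x_2,x_3)\in\mathbb{R}^3$. *)

theory Defs
  imports "HOL-Analysis.Analysis" "HOL-Computational_Algebra.Computational_Algebra"
begin

type_synonym 'a field3 = "real^3 \<Rightarrow> real \<Rightarrow> 'a"

text \<open>A field is (totally) differentiable at the space-time point \<open>(x, t)\<close>.\<close>

definition differentiable_field_at :: "'a::real_normed_vector field3 \<Rightarrow> real^3 \<Rightarrow> real \<Rightarrow> bool" where
  "differentiable_field_at F x t \<longleftrightarrow> (\<lambda>(y, s). F y s) differentiable (at (x, t))"

definition time_deriv :: "'a::real_normed_vector field3 \<Rightarrow> 'a field3" where
  "time_deriv F x t = vector_derivative (\<lambda>s. F x s) (at t)"

definition space_deriv :: "3 \<Rightarrow> 'a::real_normed_vector field3 \<Rightarrow> 'a field3" where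
  "space_deriv i F x t = vector_derivative (\<lambda>s. F (x + s *\<^sub>R axis i 1) t) (at 0)"

definition grad3 :: "real field3 \<Rightarrow> (real^3) field3" where
  "grad3 f x t = (\<chi> i. space_deriv i f x t)"

definition div3 :: "(real^3) field3 \<Rightarrow> real field3" where
  "div3 F x t = (\<Sum>i\<in>UNIV. space_deriv i (\<lambda>y s. F y s $ i) x t)"

definition curl3 :: "(real^3) field3 \<Rightarrow> (real^3) field3" where
  "curl3 F x t = vector
     [space_deriv 2 (\<lambda>y s. F y s $ 3) x t - space_deriv 3 (\<lambda>y s. F y s $ 2) x t,
      space_deriv 3 (\<lambda>y s. F y s $ 1) x t - space_deriv 1 (\<lambda>y s. F y s $ 3) x t,
      space_deriv 1 (\<lambda>y s. F y s $ 2) x t - space_deriv 2 (\<lambda>y s. F y s $ 1) x t]"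

text \<open>The equations of the reversible heat-GLM system, at the space-time point \<open>(x, t)\<close>.\<close>

definition heat_GLM_at ::
  "real \<Rightarrow> real \<Rightarrow> real field3 \<Rightarrow> (real^3) field3 \<Rightarrow> (real^3) field3 \<Rightarrow> real field3
    \<Rightarrow> real^3 \<Rightarrow> real \<Rightarrow> bool" where
  "heat_GLM_at c0 ch T J \<psi> \<phi> x t \<longleftrightarrow>
     time_deriv T x t + c0 * div3 J x t = 0 \<and>
     time_deriv J x t + c0 *\<^sub>R grad3 T x t + ch *\<^sub>R curl3 \<psi> x t = 0 \<and>
     time_deriv \<psi> x t - ch *\<^sub>R curl3 J x t + ch *\<^sub>R grad3 \<phi> x t = 0 \<and>
     time_deriv \<phi> x t + ch * div3 \<psi> x t = 0"

text \<open>
  In the index type \<open>8\<close> the numeral \<open>8\<close> equals \<open>0\<close> (likewise \<open>3 = 0\<close> in type \<open>3\<close>); \<open>vector\<close>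
  puts the list entries at the indices \<open>1, 2, \<dots>, 8\<close>.
\<close>

definition heat_GLM_state ::
  "real field3 \<Rightarrow> (real^3) field3 \<Rightarrow> (real^3) field3 \<Rightarrow> real field3 \<Rightarrow> (real^8) field3" where
  "heat_GLM_state T J \<psi> \<phi> x t = vector
     [J x t $ 1, J x t $ 2, J x t $ 3, \<phi> x t, \<psi> x t $ 1, \<psi> x t $ 2, \<psi> x t $ 3, T x t]"

text \<open>
  Friedrichs' notion for a first-order system
  \<open>A0 \<partial>\<^sub>t Q + (\<Sum>i. B i \<partial>\<^sub>i Q) = 0\<close>: the matrix \<open>A0\<close> is symmetric positive definite, and the
  spatial symbol is symmetric in every direction.
\<close>

definition symmetric_t_hyperbolic :: "real^'n^'n \<Rightarrow> ('m::finite \<Rightarrow> real^'n^'n) \<Rightarrow> bool" where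
  "symmetric_t_hyperbolic A0 B \<longleftrightarrow>
     transpose A0 = A0 \<and> (\<forall>v. v \<noteq> 0 \<longrightarrow> v \<bullet> (A0 *v v) > 0) \<and>
     (\<forall>\<beta> :: real^'m. transpose (\<Sum>i\<in>UNIV. \<beta> $ i *\<^sub>R B i) = (\<Sum>i\<in>UNIV. \<beta> $ i *\<^sub>R B i))"

definition charpoly :: "'a::comm_ring_1^'n^'n \<Rightarrow> 'a poly" where
  "charpoly A = det (mat [:0, 1:] - map_matrix (\<lambda>a. [:a:]) A)"

text \<open>
  Eigenvalues in the coefficient field with algebraic multiplicity; this multiset has as many
  elements as the matrix has rows exactly when the characteristic polynomial splits.
\<close>

definition eigenvalues :: "'a::field^'n^'n \<Rightarrow> 'a multiset" where
  "eigenvalues A = proots (charpoly A)"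

end

theory Submission
  imports Defs
begin

text \<open>Written out in the components of the state, the system consists of eight scalar
  equations whose coefficients are the rows of the matrices (\<open>heat_GLM_at_iff\<close>). Each
  matrix is symmetric because every coupling appears twice: T with J and \<phi> with \<psi> through
  a divergence and a gradient, J with \<psi> through two curls. The curl has skew coefficient
  matrices, so the opposite signs of the two curl terms make those blocks transposes of each other.
  Linear combinations stay symmetric, and the identity is the positive definite \<open>A0\<close>.

  In the first direction the matrix couples only components k and 9-k, so sums and differences of
  such unit vectors diagonalise it. The spectrum is then read off a diagonal matrix, by
  \<open>charpoly_eq_of_intertwining\<close> and \<open>eigenvalues_diagonal\<close>.\<close>

lemma exhaust_8:
  fixes i :: 8
  shows "i = 1 \<or> i = 2 \<or> i = 3 \<or> i = 4 \<or> i = 5 \<or> i = 6 \<or> i = 7 \<or> i = 8"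
proof (induct i)
  case (of_int z)
  \<comment> \<open>The representative 0 is the index 8.\<close>
  then have "z = 0 \<or> z = 1 \<or> z = 2 \<or> z = 3 \<or> z = 4 \<or> z = 5 \<or> z = 6 \<or> z = 7"
    by fastforce
  then show ?case
    by auto
qed

lemma forall_8:
  "(\<forall>i::8. P i) \<longleftrightarrow> P 1 \<and> P 2 \<and> P 3 \<and> P 4 \<and> P 5 \<and> P 6 \<and> P 7 \<and> P 8"
  by (metis exhaust_8)

lemma UNIV_8: "UNIV = {1, 2, 3, 4, 5, 6, 7, 8::8}"
  using exhaust_8 by auto

lemma sum_8: "sum f (UNIV::8 set) = f 1 + f 2 + f 3 + f 4 + f 5 + f 6 + f 7 + f 8"
  unfolding UNIV_8 by (simp add: ac_simps)

lemma vector_8 [simp]: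
  "(vector [a1, a2, a3, a4, a5, a6, a7, a8] :: 'a::zero^8) $ 1 = a1"
  "(vector [a1, a2, a3, a4, a5, a6, a7, a8] :: 'a::zero^8) $ 2 = a2"
  "(vector [a1, a2, a3, a4, a5, a6, a7, a8] :: 'a::zero^8) $ 3 = a3"
  "(vector [a1, a2, a3, a4, a5, a6, a7, a8] :: 'a::zero^8) $ 4 = a4"
  "(vector [a1, a2, a3, a4, a5, a6, a7, a8] :: 'a::zero^8) $ 5 = a5"
  "(vector [a1, a2, a3, a4, a5, a6, a7, a8] :: 'a::zero^8) $ 6 = a6"
  "(vector [a1, a2, a3, a4, a5, a6, a7, a8] :: 'a::zero^8) $ 7 = a7"
  "(vector [a1, a2, a3, a4, a5, a6, a7, a8] :: 'a::zero^8) $ 8 = a8"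
  unfolding vector_def by simp_all

lemma matrix_diff_ldistrib:
  fixes A :: "'a::ring_1^'n^'m" and B C :: "'a^'p^'n"
  shows "A ** (B - C) = A ** B - A ** C"
  by (simp add: vec_eq_iff matrix_matrix_mult_def right_diff_distrib sum_subtractf)

lemma matrix_diff_rdistrib:
  fixes A B :: "'a::ring_1^'n^'m" and C :: "'a^'p^'n"
  shows "(A - B) ** C = A ** C - B ** C"
  by (simp add: vec_eq_iff matrix_matrix_mult_def left_diff_distrib sum_subtractf)

text \<open>Over polynomials the scalar matrix \<open>X\<close> commutes with the lifted
  \<open>P\<close>, so the intertwining relation passes to \<open>X - lift A\<close> and
  \<open>X - lift D\<close>. Taking determinants, the nonzero factor \<open>det (lift P)\<close>
  cancels in the polynomial domain.\<close>

lemma charpoly_eq_of_intertwining: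
  fixes A D P :: "'a::idom^'n^'n"
  assumes PA: "P ** A = D ** P" and P: "det P \<noteq> 0"
  shows "charpoly A = charpoly D"
proof -
  define X :: "'a poly^'n^'n" where "X = mat [:0, 1:]"
  define lift :: "'a^'n^'n \<Rightarrow> 'a poly^'n^'n" where "lift = map_matrix (\<lambda>a. [:a:])"
  have sum_const: "(\<Sum>i\<in>S. [:f i:]) = [:\<Sum>i\<in>S. f i:]" for S and f :: "'n \<Rightarrow> 'a"
    by (induction S rule: infinite_finite_induct) auto
  have lift_mult: "lift (M ** N) = lift M ** lift N" for M N
    by (simp add: lift_def vec_eq_iff matrix_matrix_mult_def sum_const mult.commute)
  have X_comm: "M ** X = X ** M" for M
    by (simp add: X_def vec_eq_iff matrix_matrix_mult_def mat_def if_distrib if_distribR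
        sum.delta sum.delta' mult.commute cong: if_cong)
  \<comment> \<open>Evaluation at 0 turns the constant polynomials back into the entries of
    \<open>P\<close>.\<close>
  have "poly (det (lift P)) 0 = det P"
    by (simp add: det_def lift_def poly_sum poly_prod)
  then have lift_P: "det (lift P) \<noteq> 0"
    using P by force
  have "lift P ** (X - lift A) = (X - lift D) ** lift P"
    by (simp add: matrix_diff_ldistrib matrix_diff_rdistrib X_comm flip: lift_mult PA)
  then have "det (lift P) * det (X - lift A) = det (X - lift D) * det (lift P)"
    by (metis det_mul)
  with lift_P show ?thesis
    by (simp add: charpoly_def X_def lift_def)
qed

lemma eigenvalues_diagonal:
  fixes d :: "'n::finite \<Rightarrow> 'a::field"
  shows "eigenvalues (\<chi> i j. if i = j then d i else 0) = (\<Sum>i\<in>UNIV. {#d i#})"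
proof -
  have "charpoly (\<chi> i j. if i = j then d i else 0) = (\<Prod>i\<in>UNIV. [:- d i, 1:])"
    unfolding charpoly_def by (subst det_diagonal) (auto simp: mat_def)
  then show ?thesis
    by (simp add: eigenvalues_def proots_prod)
qed

lemma differentiable_field_at_nth:
  "differentiable_field_at F x t \<Longrightarrow> differentiable_field_at (\<lambda>y s. F y s $ k) x t"
  unfolding differentiable_field_at_def differentiable_def case_prod_beta
  by (elim exE) (rule exI, erule bounded_linear.has_derivative[OF bounded_linear_vec_nth])

lemma differentiable_field_at_time:
  assumes "differentiable_field_at F x t"
  shows "(\<lambda>s. F x s) differentiable (at t)"
proof -
  have "(\<lambda>s. (x, s)) differentiable (at t)"
    by (auto simp: differentiable_def intro!: exI derivative_eq_intros)
  then have "((\<lambda>(y, s). F y s) \<circ> (\<lambda>s. (x, s))) differentiable (at t)"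
    using assms by (intro differentiable_chain_at) (auto simp: differentiable_field_at_def)
  then show ?thesis
    by (simp add: o_def)
qed

lemma differentiable_field_at_space:
  assumes "differentiable_field_at F x t"
  shows "(\<lambda>s. F (x + s *\<^sub>R axis i 1) t) differentiable (at 0)"
proof -
  have "(\<lambda>s. (x + s *\<^sub>R axis i 1, t)) differentiable (at 0)"
    by (auto simp: differentiable_def intro!: exI derivative_eq_intros)
  then have "((\<lambda>(y, s). F y s) \<circ> (\<lambda>s. (x + s *\<^sub>R axis i 1, t))) differentiable (at 0)"
    using assms by (intro differentiable_chain_at) (auto simp: differentiable_field_at_def)
  then show ?thesis
    by (simp add: o_def)
qed

text \<open>Since \<open>vector_derivative\<close> is a choice operator, it is informative only
  where a derivative exists. Differentiable components provide one for the vector function, and the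
  bounded linear projection carries it to each component.\<close>

lemma vector_derivative_nth:
  fixes f :: "real \<Rightarrow> real^'n"
  assumes "\<And>k. (\<lambda>s. f s $ k) differentiable (at a)"
  shows "vector_derivative f (at a) $ k = vector_derivative (\<lambda>s. f s $ k) (at a)"
proof -
  have "f differentiable (at a)"
    by (subst differentiable_componentwise_within)
      (use assms in \<open>auto simp: Basis_vec_def inner_axis\<close>)
  then have "(f has_vector_derivative vector_derivative f (at a)) (at a)"
    by (simp add: vector_derivative_works)
  then have "((\<lambda>s. f s $ k) has_vector_derivative vector_derivative f (at a) $ k) (at a)"
    by (rule bounded_linear.has_vector_derivative[OF bounded_linear_vec_nth])
  then show ?thesis
    by (simp add: vector_derivative_at)
qed

lemma time_deriv_nth:
  fixes F :: "(real^'n) field3"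
  assumes "\<And>k. differentiable_field_at (\<lambda>y s. F y s $ k) x t"
  shows "time_deriv F x t $ k = time_deriv (\<lambda>y s. F y s $ k) x t"
  unfolding time_deriv_def
  by (rule vector_derivative_nth) (rule differentiable_field_at_time[OF assms])

lemma space_deriv_nth:
  fixes F :: "(real^'n) field3"
  assumes "\<And>k. differentiable_field_at (\<lambda>y s. F y s $ k) x t"
  shows "space_deriv i F x t $ k = space_deriv i (\<lambda>y s. F y s $ k) x t"
  unfolding space_deriv_def
  by (rule vector_derivative_nth) (rule differentiable_field_at_space[OF assms])

lemma differentiable_heat_GLM_state_nth:
  assumes "differentiable_field_at T x t" "differentiable_field_at J x t"
    "differentiable_field_at \<psi> x t" "differentiable_field_at \<phi> x t"
  shows "differentiable_field_at (\<lambda>y s. heat_GLM_state T J \<psi> \<phi> y s $ k) x t"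
  using assms exhaust_8[of k]
  by (auto simp: heat_GLM_state_def differentiable_field_at_nth)

text \<open>The three matrices are packed into one vector so that \<open>i\<close> selects the
  direction. The entries \<open>c0\<close> couple J_i with T, the entries \<open>ch\<close> between
  slots 4 and 4+i couple \<phi> with \<psi>_i, and the remaining ones are the curl
  coefficients.\<close>

definition heat_GLM_matrix :: "real \<Rightarrow> real \<Rightarrow> 3 \<Rightarrow> real^8^8" where
  "heat_GLM_matrix c0 ch i = (vector [
     vector
      [vector [0, 0, 0, 0, 0, 0, 0, c0],
       vector [0, 0, 0, 0, 0, 0, - ch, 0],
       vector [0, 0, 0, 0, 0, ch, 0, 0],
       vector [0, 0, 0, 0, ch, 0, 0, 0],
       vector [0, 0, 0, ch, 0, 0, 0, 0],
       vector [0, 0, ch, 0, 0, 0, 0, 0],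
       vector [0, - ch, 0, 0, 0, 0, 0, 0],
       vector [c0, 0, 0, 0, 0, 0, 0, 0]],
     vector
      [vector [0, 0, 0, 0, 0, 0, ch, 0],
       vector [0, 0, 0, 0, 0, 0, 0, c0],
       vector [0, 0, 0, 0, - ch, 0, 0, 0],
       vector [0, 0, 0, 0, 0, ch, 0, 0],
       vector [0, 0, - ch, 0, 0, 0, 0, 0],
       vector [0, 0, 0, ch, 0, 0, 0, 0],
       vector [ch, 0, 0, 0, 0, 0, 0, 0],
       vector [0, c0, 0, 0, 0, 0, 0, 0]],
     vector
      [vector [0, 0, 0, 0, 0, - ch, 0, 0],
       vector [0, 0, 0, 0, ch, 0, 0, 0],
       vector [0, 0, 0, 0, 0, 0, 0, c0],
       vector [0, 0, 0, 0, 0, 0, ch, 0],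
       vector [0, ch, 0, 0, 0, 0, 0, 0],
       vector [- ch, 0, 0, 0, 0, 0, 0, 0],
       vector [0, 0, 0, ch, 0, 0, 0, 0],
       vector [0, 0, c0, 0, 0, 0, 0, 0]]] :: real^8^8^3) $ i"

lemma heat_GLM_at_iff:
  assumes T: "differentiable_field_at T x t" and J: "differentiable_field_at J x t"
    and \<psi>: "differentiable_field_at \<psi> x t" and \<phi>: "differentiable_field_at \<phi> x t"
  shows "heat_GLM_at c0 ch T J \<psi> \<phi> x t \<longleftrightarrow>
    time_deriv (heat_GLM_state T J \<psi> \<phi>) x t +
      (\<Sum>i\<in>UNIV. heat_GLM_matrix c0 ch i *v space_deriv i (heat_GLM_state T J \<psi> \<phi>) x t) = 0"
proof -
  note state = differentiable_heat_GLM_state_nth[OF assms]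
  have J_t: "time_deriv J x t $ k = time_deriv (\<lambda>y s. J y s $ k) x t"
    and \<psi>_t: "time_deriv \<psi> x t $ k = time_deriv (\<lambda>y s. \<psi> y s $ k) x t" for k
    using J \<psi> by (auto intro!: time_deriv_nth differentiable_field_at_nth)
  show ?thesis
    \<comment> \<open>The first call moves derivatives of the state to its components; the second
      identifies these components with the physical fields.\<close>
    by (simp add: heat_GLM_at_def vec_eq_iff forall_3 forall_8 sum_3 sum_8 matrix_vector_mult_def
        time_deriv_nth[OF state] space_deriv_nth[OF state] heat_GLM_matrix_def J_t \<psi>_t
        grad3_def div3_def curl3_def, simp add: heat_GLM_state_def)
      (auto simp: algebra_simps)
qed

lemma transpose_heat_GLM_matrix: "transpose (heat_GLM_matrix c0 ch i) = heat_GLM_matrix c0 ch i"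
  using exhaust_3[of i] by (auto simp: heat_GLM_matrix_def transpose_def vec_eq_iff forall_8)

lemma transpose_symbol:
  fixes B :: "'m::finite \<Rightarrow> real^'n^'n"
  assumes "\<And>i. transpose (B i) = B i"
  shows "transpose (\<Sum>i\<in>UNIV. \<beta> $ i *\<^sub>R B i) = (\<Sum>i\<in>UNIV. \<beta> $ i *\<^sub>R B i)"
proof -
  have "B i $ k $ l = B i $ l $ k" for i k l
    by (metis assms transpose_def vec_lambda_beta)
  then show ?thesis
    by (simp add: transpose_def vec_eq_iff sum_component)
qed

text \<open>
  The matrix \<open>B\<^sub>1\<close> is antidiagonal and symmetric, so the vectors \<open>e\<^sub>k + e\<^bsub>9-k\<^esub>\<close> and
  \<open>e\<^bsub>9-k\<^esub> - e\<^sub>k\<close>, for \<open>k = 1, \<dots>, 4\<close>, are eigenvectors; they form the rows of the matrix \<open>P\<close> below.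
\<close>

lemma eigenvalues_heat_GLM_matrix_1:
  "eigenvalues (heat_GLM_matrix c0 ch 1) = {#- c0, - ch, - ch, - ch, ch, ch, ch, c0#}"
proof -
  define P :: "real^8^8" where "P = vector
    [vector [1, 0, 0, 0, 0, 0, 0, 1],
     vector [0, 1, 0, 0, 0, 0, 1, 0],
     vector [0, 0, 1, 0, 0, 1, 0, 0],
     vector [0, 0, 0, 1, 1, 0, 0, 0],
     vector [0, 0, 0, - 1, 1, 0, 0, 0],
     vector [0, 0, - 1, 0, 0, 1, 0, 0],
     vector [0, - 1, 0, 0, 0, 0, 1, 0],
     vector [- 1, 0, 0, 0, 0, 0, 0, 1]]"
  \<comment> \<open>Entry k is the eigenvalue of row k of \<open>P\<close>: the antidiagonal entry
    for a sum, its negative for a difference.\<close>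
  define d :: "real^8" where "d = vector [c0, - ch, ch, ch, - ch, - ch, ch, - c0]"
  define D :: "real^8^8" where "D = (\<chi> i j. if i = j then d $ i else 0)"
  have PB: "P ** heat_GLM_matrix c0 ch 1 = D ** P"
    by (simp add: vec_eq_iff forall_8 matrix_matrix_mult_def sum_8 P_def D_def d_def
        heat_GLM_matrix_def)
  \<comment> \<open>The rows are orthogonal with squared length 2, which gives \<open>det P\<close>
    nonzero without expanding it.\<close>
  have "P ** transpose P = mat 2"
    by (simp add: vec_eq_iff forall_8 matrix_matrix_mult_def sum_8 P_def transpose_def mat_def)
  then have "det P * det P = det (mat 2 :: real^8^8)"
    by (metis det_mul det_transpose)
  also have "\<dots> \<noteq> 0"
    by (subst det_diagonal) (auto simp: mat_def)
  finally have "det P \<noteq> 0"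
    by auto
  then have "eigenvalues (heat_GLM_matrix c0 ch 1) = eigenvalues D"
    using charpoly_eq_of_intertwining[OF PB] by (simp add: eigenvalues_def)
  also have "\<dots> = {#- c0, - ch, - ch, - ch, ch, ch, ch, c0#}"
    unfolding D_def eigenvalues_diagonal by (simp add: sum_8 d_def)
  finally show ?thesis .
qed

theorem mainTheorem2:
  fixes c0 ch :: real
  shows "\<exists>B :: 3 \<Rightarrow> real^8^8.
    (\<forall>(T :: real field3) (J :: (real^3) field3) (\<psi> :: (real^3) field3) (\<phi> :: real field3) x t.
        differentiable_field_at T x t \<and> differentiable_field_at J x t \<and>
        differentiable_field_at \<psi> x t \<and> differentiable_field_at \<phi> x t \<longrightarrow>
        (heat_GLM_at c0 ch T J \<psi> \<phi> x t \<longleftrightarrow>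
          time_deriv (heat_GLM_state T J \<psi> \<phi>) x t +
            (\<Sum>i\<in>UNIV. B i *v space_deriv i (heat_GLM_state T J \<psi> \<phi>) x t) = 0)) \<and>
    (\<forall>\<beta> :: real^3. transpose (\<Sum>i\<in>UNIV. \<beta> $ i *\<^sub>R B i) = (\<Sum>i\<in>UNIV. \<beta> $ i *\<^sub>R B i)) \<and>
    symmetric_t_hyperbolic (mat 1) B \<and>
    eigenvalues (B 1) = {#- c0, - ch, - ch, - ch, ch, ch, ch, c0#}"
proof (intro exI[of _ "heat_GLM_matrix c0 ch"] conjI)
  note symbol = transpose_symbol[OF transpose_heat_GLM_matrix]
  show "\<forall>\<beta> :: real^3. transpose (\<Sum>i\<in>UNIV. \<beta> $ i *\<^sub>R heat_GLM_matrix c0 ch i) =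
      (\<Sum>i\<in>UNIV. \<beta> $ i *\<^sub>R heat_GLM_matrix c0 ch i)"
    by (simp add: symbol)
  show "symmetric_t_hyperbolic (mat 1) (heat_GLM_matrix c0 ch)"
    by (simp add: symmetric_t_hyperbolic_def symbol)
qed (use heat_GLM_at_iff eigenvalues_heat_GLM_matrix_1 in blast)+

end
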